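(* Let $d \geq 3$ be an integer. There exist constants $C>0$ and $c>0$ (depending only on $d$) such that the following holds. Let $q$ be an odd prime power, let $\mathbb{F}_q$ be the finite field with $q$ elements, and let \[S^{d-1} = \{x \in \mathbb{F}_q^d : x_1^2 + \cdots + x_d^2 = 1\}\] be the unit sphere in $\mathbb{F}_q^d$. If $E \subset S^{d-1}$ satisfies $|E| \geq C q^{d/2}$, then the distance set \[\Delta(E) = \{\|x-y\| : x,y \in E\} \subset \mathbb{F}_q\] satisfies $|\Delta(E)| > c q$.
   Context: For $x,y \in \mathbb{F}_q^d$, the (finite-field) distance is defined as $\|x-y\| = (x_1-y_1)^2 + \cdots + (x_d-y_d)^2 \in \mathbb{F}_q$; it is an element of $\mathbb{F}_q$, not a norm. The constants $C$ (taken sufficiently large) and $c$ do not depend on $q$ or $E$. *)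

theory Defs
  imports "HOL-Algebra.Algebra" "HOL-Number_Theory.Prime_Powers" Complex_Main
begin

text \<open>
  Since the number \<open>q\<close> of elements is quantified inside the theorem, after the constants have been
  chosen, the field is a record \<open>F\<close> with an explicit carrier rather than a type of class field.
  A point of \<open>F\<^sup>d\<close> is an extensional function on the index set \<open>{1..d}\<close>: it is undefined
  outside \<open>{1..d}\<close>, so that distinct functions are distinct points.
\<close>

definition affine_space :: "('a, 'b) ring_scheme \<Rightarrow> nat \<Rightarrow> (nat \<Rightarrow> 'a) set" where
  "affine_space F d = {1..d} \<rightarrow>\<^sub>E carrier F"

definition ff_dist :: "('a, 'b) ring_scheme \<Rightarrow> nat \<Rightarrow> (nat \<Rightarrow> 'a) \<Rightarrow> (nat \<Rightarrow> 'a) \<Rightarrow> 'a" where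
  "ff_dist F d x y = (\<Oplus>\<^bsub>F\<^esub>i\<in>{1..d}. (x i \<ominus>\<^bsub>F\<^esub> y i) [^]\<^bsub>F\<^esub> (2::nat))"

definition unit_sphere :: "('a, 'b) ring_scheme \<Rightarrow> nat \<Rightarrow> (nat \<Rightarrow> 'a) set" where
  "unit_sphere F d =
     {x \<in> affine_space F d. (\<Oplus>\<^bsub>F\<^esub>i\<in>{1..d}. x i [^]\<^bsub>F\<^esub> (2::nat)) = \<one>\<^bsub>F\<^esub>}"

definition distance_set :: "('a, 'b) ring_scheme \<Rightarrow> nat \<Rightarrow> (nat \<Rightarrow> 'a) set \<Rightarrow> 'a set" where
  "distance_set F d E = {ff_dist F d x y | x y. x \<in> E \<and> y \<in> E}"

text \<open>
  In the theorem the type \<open>'a\<close> of field elements is arbitrary and fixed before the constants.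
  The instance \<open>'a = nat\<close> already yields constants depending on \<open>d\<close> only, because every finite
  field is isomorphic to one whose carrier is a set of natural numbers.
\<close>

end

theory Submission
  imports Defs "HOL-Analysis.Convex"
begin

text \<open>
  For \<open>x\<close>, \<open>y\<close> on the unit sphere the distance is \<open>2 - 2 (x \<bullet> y)\<close>, so for odd \<open>q\<close> it suffices to
  count the dot products. For a vector \<open>v\<close> let \<open>N v\<close> be the number of pairs \<open>(y, y')\<close> in
  \<open>E \<times> E\<close> with \<open>v \<bullet> y = v \<bullet> y'\<close>. By Cauchy--Schwarz \<open>N v \<ge> |E|\<^sup>2 / q\<close>, while averaging over all
  \<open>v\<close> shows that the total excess \<open>\<Sum>\<^sub>v (N v - |E|\<^sup>2 / q)\<close> is at most \<open>|E| q\<^sup>d\<^sup>-\<^sup>1 (q - 1)\<close>. The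
  excess is constant on punctured lines through the origin, and such a line meets the sphere in at
  most two points, so the excess summed over \<open>E\<close> is at most \<open>2 |E| q\<^sup>d\<^sup>-\<^sup>1\<close>. A second application of
  Cauchy--Schwarz, with the set of dot products in place of the field, bounds the number of dot
  products from below.
\<close>

section \<open>Collision counts as second moments of fibre sizes\<close>

definition collisions :: "('b \<Rightarrow> 'c) \<Rightarrow> 'b set \<Rightarrow> nat" where
  "collisions f E = card {p \<in> E \<times> E. f (fst p) = f (snd p)}"

text \<open>Sorting the colliding pairs by their common value \<open>t\<close> gives the squares of
  the fibres. Values of \<open>K\<close> outside the image have empty fibres and contribute
  zero.\<close>

lemma collisions_eq_sum:
  assumes "finite E" "finite K" "f ` E \<subseteq> K"
  shows "collisions f E = (\<Sum>t\<in>K. (card {y \<in> E. f y = t})\<^sup>2)"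
proof -
  have "{p \<in> E \<times> E. f (fst p) = f (snd p)}
      = (\<Union>t\<in>K. {y \<in> E. f y = t} \<times> {y \<in> E. f y = t})"
    using assms(3) by auto
  moreover have "card (\<Union>t\<in>K. {y \<in> E. f y = t} \<times> {y \<in> E. f y = t})
      = (\<Sum>t\<in>K. card ({y \<in> E. f y = t} \<times> {y \<in> E. f y = t}))"
    using assms by (intro card_UN_disjoint) auto
  ultimately show ?thesis
    by (simp add: collisions_def card_cartesian_product power2_eq_square)
qed

text \<open>Cauchy--Schwarz for the fibre sizes against the constant 1. \<open>K\<close> is kept
  free for two uses: the whole field, to see that an excess is nonnegative, and the set of dot
  products, whose size is to be bounded below.\<close>

lemma card_squared_le_collisions:
  assumes "finite E" "finite K" "f ` E \<subseteq> K"
  shows "(real (card E))\<^sup>2 \<le> real (card K) * real (collisions f E)"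
proof -
  have "card E = (\<Sum>t\<in>K. card {y \<in> E. f y = t})"
    using sum.group[OF assms, of "\<lambda>_. 1::nat"] by simp
  then have "(real (card E))\<^sup>2 = (\<Sum>t\<in>K. 1 * real (card {y \<in> E. f y = t}))\<^sup>2"
    by simp
  also have "\<dots> \<le> (\<Sum>t\<in>K. 1\<^sup>2) * (\<Sum>t\<in>K. (real (card {y \<in> E. f y = t}))\<^sup>2)"
    by (rule Cauchy_Schwarz_ineq_sum)
  also have "\<dots> = real (card K) * real (collisions f E)"
    using collisions_eq_sum[OF assms] by simp
  finally show ?thesis .
qed

lemma card_filter_eq_sum:
  "finite B \<Longrightarrow> card {x \<in> B. P x} = (\<Sum>x\<in>B. if P x then 1 else 0)"
  using sum.inter_filter[of B "\<lambda>_. 1::nat" P] by simp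

text \<open>Double counting: instead of colliding pairs for each \<open>v\<close>, count the vectors
  \<open>v\<close> for each pair. With \<open>g\<close> the dot product, these counts are bounded by
  \<open>card_hyperplane_le\<close>.\<close>

lemma sum_collisions:
  assumes "finite A" "finite E"
  shows "(\<Sum>v\<in>A. collisions (g v) E) = (\<Sum>p\<in>E \<times> E. card {v \<in> A. g v (fst p) = g v (snd p)})"
proof -
  have "(\<Sum>v\<in>A. collisions (g v) E)
      = (\<Sum>v\<in>A. \<Sum>p\<in>E \<times> E. if g v (fst p) = g v (snd p) then 1 else 0)"
    unfolding collisions_def using assms by (simp only: card_filter_eq_sum finite_cartesian_product)
  also have "\<dots> = (\<Sum>p\<in>E \<times> E. \<Sum>v\<in>A. if g v (fst p) = g v (snd p) then 1 else 0)"
    by (rule sum.swap)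
  also have "\<dots> = (\<Sum>p\<in>E \<times> E. card {v \<in> A. g v (fst p) = g v (snd p)})"
    using assms by (simp only: card_filter_eq_sum)
  finally show ?thesis .
qed

section \<open>Dot products, hyperplanes and dilations\<close>

definition dot_prod :: "('a, 'b) ring_scheme \<Rightarrow> nat \<Rightarrow> (nat \<Rightarrow> 'a) \<Rightarrow> (nat \<Rightarrow> 'a) \<Rightarrow> 'a" where
  "dot_prod F d x y = (\<Oplus>\<^bsub>F\<^esub>i\<in>{1..d}. x i \<otimes>\<^bsub>F\<^esub> y i)"

text \<open>The restriction to \<open>{1..d}\<close> keeps the multiple extensional, hence a point
  of \<open>affine_space F d\<close>.\<close>

definition scale_vec :: "('a, 'b) ring_scheme \<Rightarrow> nat \<Rightarrow> 'a \<Rightarrow> (nat \<Rightarrow> 'a) \<Rightarrow> nat \<Rightarrow> 'a" where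
  "scale_vec F d s x = (\<lambda>i\<in>{1..d}. s \<otimes>\<^bsub>F\<^esub> x i)"

lemma affine_space_coord: "x \<in> affine_space F d \<Longrightarrow> i \<in> {1..d} \<Longrightarrow> x i \<in> carrier F"
  by (auto simp: affine_space_def)

lemma affine_space_eqI:
  "x \<in> affine_space F d \<Longrightarrow> y \<in> affine_space F d \<Longrightarrow> (\<And>i. i \<in> {1..d} \<Longrightarrow> x i = y i) \<Longrightarrow> x = y"
  unfolding affine_space_def by (rule PiE_ext)

context field
begin

lemma dot_prod_closed:
  "x \<in> affine_space R d \<Longrightarrow> y \<in> affine_space R d \<Longrightarrow> dot_prod R d x y \<in> carrier R"
  by (auto simp: dot_prod_def intro!: finsum_closed m_closed intro: affine_space_coord)

lemma scale_vec_closed: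
  "s \<in> carrier R \<Longrightarrow> x \<in> affine_space R d \<Longrightarrow> scale_vec R d s x \<in> affine_space R d"
  by (auto simp: scale_vec_def affine_space_def)

lemma dot_prod_scale_left:
  assumes "s \<in> carrier R" "x \<in> affine_space R d" "y \<in> affine_space R d"
  shows "dot_prod R d (scale_vec R d s x) y = s \<otimes> dot_prod R d x y"
proof -
  have "dot_prod R d (scale_vec R d s x) y = (\<Oplus>i\<in>{1..d}. s \<otimes> (x i \<otimes> y i))"
    unfolding dot_prod_def scale_vec_def using assms
    by (intro finsum_cong') (auto simp: affine_space_coord m_assoc)
  also have "\<dots> = s \<otimes> (\<Oplus>i\<in>{1..d}. x i \<otimes> y i)"
    using assms by (intro finsum_rdistr[symmetric]) (auto simp: affine_space_coord)
  finally show ?thesis by (simp add: dot_prod_def)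
qed

lemma dot_prod_commute:
  assumes "x \<in> affine_space R d" "y \<in> affine_space R d"
  shows "dot_prod R d x y = dot_prod R d y x"
  unfolding dot_prod_def using assms
  by (intro finsum_cong') (auto simp: affine_space_coord m_comm)

lemma unit_sphere_dot_prod:
  assumes "x \<in> unit_sphere R d"
  shows "x \<in> affine_space R d" "dot_prod R d x x = \<one>"
proof -
  show x: "x \<in> affine_space R d"
    using assms by (simp add: unit_sphere_def)
  have "dot_prod R d x x = (\<Oplus>i\<in>{1..d}. x i [^] (2::nat))"
    unfolding dot_prod_def using x
    by (intro finsum_cong') (auto simp: affine_space_coord numeral_2_eq_2)
  then show "dot_prod R d x x = \<one>"
    using assms by (simp add: unit_sphere_def)
qed

text \<open>The factor \<open>s\<close> comes out of both dot products and cancels. This makes the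
  collision count constant on punctured lines through the origin.\<close>

lemma collisions_scale:
  assumes "s \<in> carrier R" "s \<noteq> \<zero>" "x \<in> affine_space R d" "E \<subseteq> affine_space R d"
  shows "collisions (dot_prod R d (scale_vec R d s x)) E = collisions (dot_prod R d x) E"
proof -
  have "dot_prod R d (scale_vec R d s x) y = dot_prod R d (scale_vec R d s x) z
      \<longleftrightarrow> dot_prod R d x y = dot_prod R d x z" if "y \<in> E" "z \<in> E" for y z
    using assms that m_lcancel[of s] by (auto simp: dot_prod_scale_left dot_prod_closed subset_iff)
  then show ?thesis
    unfolding collisions_def by (intro arg_cong[where f = card]) auto
qed

text \<open>In a coordinate \<open>i\<close> where \<open>y\<close> and \<open>z\<close> differ, the
  linear condition on \<open>v\<close> has the nonzero coefficient \<open>y i - z i\<close>, so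
  \<open>v i\<close> is determined by the other \<open>d - 1\<close> coordinates.\<close>

lemma card_hyperplane_le:
  assumes fin: "finite (carrier R)"
    and y: "y \<in> affine_space R d" and z: "z \<in> affine_space R d" and "y \<noteq> z"
  shows "card {v \<in> affine_space R d. dot_prod R d v y = dot_prod R d v z}
    \<le> card (carrier R) ^ (d - 1)" (is "card ?H \<le> _")
proof -
  obtain i where i: "i \<in> {1..d}" and ne: "y i \<noteq> z i"
    using affine_space_eqI[OF y z] \<open>y \<noteq> z\<close> by auto
  define J where "J = {1..d} - {i}"
  have J: "{1..d} = insert i J" "finite J" "i \<notin> J"
    using i by (auto simp: J_def)
  have split: "dot_prod R d v u = v i \<otimes> u i \<oplus> (\<Oplus>j\<in>J. v j \<otimes> u j)"
    if "v \<in> affine_space R d" "u \<in> affine_space R d" for v u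
  proof -
    have "v j \<in> carrier R" "u j \<in> carrier R" if "j \<in> insert i J" for j
      using that J(1) \<open>v \<in> _\<close> \<open>u \<in> _\<close> by (auto intro: affine_space_coord)
    then show ?thesis
      unfolding dot_prod_def J(1) using J by (intro finsum_insert) auto
  qed
  have "inj_on (\<lambda>v. restrict v J) ?H"
  proof (rule inj_onI)
    fix v w assume v: "v \<in> ?H" and w: "w \<in> ?H" and eq: "restrict v J = restrict w J"
    have vw: "v j = w j" if "j \<in> J" for j
      using fun_cong[OF eq, of j] that by simp
    have carr: "v i \<in> carrier R" "w i \<in> carrier R" "y i \<in> carrier R" "z i \<in> carrier R"
      using v w y z i by (auto intro: affine_space_coord)
    have rest: "(\<Oplus>j\<in>J. v j \<otimes> u j) = (\<Oplus>j\<in>J. w j \<otimes> u j)"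
      "(\<Oplus>j\<in>J. w j \<otimes> u j) \<in> carrier R" if "u \<in> affine_space R d" for u
      using w that J(1) vw
      by (auto intro!: finsum_cong' finsum_closed m_closed intro: affine_space_coord)
    define a b where "a = (\<Oplus>j\<in>J. w j \<otimes> y j)" and "b = (\<Oplus>j\<in>J. w j \<otimes> z j)"
    have ab: "a \<in> carrier R" "b \<in> carrier R"
      using rest(2) y z by (auto simp: a_def b_def)
    \<comment> \<open>Here \<open>a\<close> and \<open>b\<close> depend only on the coordinates in
      \<open>J\<close>, which \<open>v\<close> and \<open>w\<close> share, so \<open>v i\<close> and
      \<open>w i\<close> solve the same linear equation.\<close>
    have shift: "u \<otimes> (y i \<ominus> z i) = b \<ominus> a"
      if "u \<in> carrier R" "u \<otimes> y i \<oplus> a = u \<otimes> z i \<oplus> b" for u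
    proof -
      have "u \<otimes> (y i \<ominus> z i) = (u \<otimes> y i \<oplus> a) \<ominus> a \<ominus> u \<otimes> z i"
        using carr ab that(1) by algebra
      also have "\<dots> = b \<ominus> a"
        unfolding that(2) using carr ab that(1) by algebra
      finally show ?thesis .
    qed
    have "v i \<otimes> y i \<oplus> a = v i \<otimes> z i \<oplus> b"
      using v y z split[of v] rest(1) by (simp add: a_def b_def)
    moreover have "w i \<otimes> y i \<oplus> a = w i \<otimes> z i \<oplus> b"
      using w y z split[of w] by (simp add: a_def b_def)
    ultimately have "v i \<otimes> (y i \<ominus> z i) = w i \<otimes> (y i \<ominus> z i)"
      using carr shift by simp
    moreover have "y i \<ominus> z i \<noteq> \<zero>"
      using ne carr by (simp add: r_right_minus_eq)
    ultimately have "v i = w i"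
      using carr by (simp add: m_rcancel)
    then show "v = w"
      using v w vw J(1) by (intro affine_space_eqI[of v R d]) auto
  qed
  moreover have "(\<lambda>v. restrict v J) ` ?H \<subseteq> J \<rightarrow>\<^sub>E carrier R"
    using J(1) by (auto simp: affine_space_def)
  moreover have "finite (J \<rightarrow>\<^sub>E carrier R)"
    using J(2) fin by (simp add: finite_PiE)
  ultimately have "card ?H \<le> card (J \<rightarrow>\<^sub>E carrier R)"
    by (rule card_inj_on_le)
  also have "\<dots> = card (carrier R) ^ (d - 1)"
    using J(2) i by (simp add: card_PiE J_def)
  finally show ?thesis .
qed

lemma squares_eq:
  assumes "a \<in> carrier R" "b \<in> carrier R" "a \<otimes> a = b \<otimes> b"
  shows "a = b \<or> a = \<ominus> b"
proof -
  have "(a \<ominus> b) \<otimes> (a \<oplus> b) = a \<otimes> a \<ominus> b \<otimes> b"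
    using assms(1,2) by algebra
  also have "\<dots> = \<zero>"
    using assms by simp
  finally have "a \<ominus> b = \<zero> \<or> a \<oplus> b = \<zero>"
    using assms(1,2) by (simp add: integral_iff)
  then show ?thesis
    using assms(1,2) by (auto simp: r_right_minus_eq dest: minus_equality[symmetric] sum_zero_eq_neg)
qed

text \<open>If \<open>v\<close> is \<open>s\<close> times a point \<open>x\<close> of the sphere,
  then \<open>v \<bullet> v = s * s\<close>, which leaves at most two choices of \<open>s\<close>;
  as \<open>s\<close> is nonzero, it determines \<open>x\<close>.\<close>

lemma card_scale_fibre_le_2:
  assumes E: "E \<subseteq> unit_sphere R d"
  shows "card {p \<in> (carrier R - {\<zero>}) \<times> E. scale_vec R d (fst p) (snd p) = v} \<le> 2"
    (is "card ?P \<le> 2")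
proof (cases "?P = {}")
  case False
  then obtain s x where sx: "(s, x) \<in> ?P"
    by auto
  have norm: "t \<otimes> t = dot_prod R d v v" if "(t, y) \<in> ?P" for t y
  proof -
    have y: "y \<in> affine_space R d" "dot_prod R d y y = \<one>" and t: "t \<in> carrier R"
      and v: "v = scale_vec R d t y"
      using that E unit_sphere_dot_prod[of y d] by auto
    have "dot_prod R d v v = t \<otimes> dot_prod R d y v"
      using y t unfolding v by (intro dot_prod_scale_left scale_vec_closed)
    also have "dot_prod R d y v = dot_prod R d v y"
      using y t unfolding v by (intro dot_prod_commute scale_vec_closed)
    also have "\<dots> = t"
      using y t unfolding v by (simp add: dot_prod_scale_left)
    finally show ?thesis by simp
  qed
  have "inj_on fst ?P"
  proof (rule inj_onI)
    fix p p' assume p: "p \<in> ?P" "p' \<in> ?P" "fst p = fst p'"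
    obtain t y y' where eq: "p = (t, y)" "p' = (t, y')"
      using p(3) by (metis prod.collapse)
    have aff: "y \<in> affine_space R d" "y' \<in> affine_space R d"
      using p E unit_sphere_dot_prod(1) by (auto simp: eq)
    have "y i = y' i" if i: "i \<in> {1..d}" for i
    proof -
      have "scale_vec R d t y i = scale_vec R d t y' i"
        using p(1,2) by (simp add: eq)
      then have "t \<otimes> y i = t \<otimes> y' i"
        using i by (simp add: scale_vec_def)
      then show ?thesis
        using p aff i by (simp add: eq m_lcancel affine_space_coord)
    qed
    then show "p = p'"
      unfolding eq using aff affine_space_eqI by blast
  qed
  moreover have "fst ` ?P \<subseteq> {s, \<ominus> s}"
  proof
    fix t assume "t \<in> fst ` ?P"
    then obtain p where "p \<in> ?P" "t = fst p"
      by blast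
    then have ty: "(t, snd p) \<in> ?P"
      by simp
    then show "t \<in> {s, \<ominus> s}"
      using squares_eq[of t s] norm[OF ty] norm[OF sx] sx by auto
  qed
  ultimately have "card ?P \<le> card {s, \<ominus> s}"
    by (intro card_inj_on_le) auto
  also have "\<dots> \<le> 2"
    by (simp add: card_insert_le_m1)
  finally show ?thesis .
next
  case True
  then show ?thesis
    by (simp only: card.empty)
qed

section \<open>Collisions averaged over the whole space and over the sphere\<close>

lemma finite_affine_space: "finite (carrier R) \<Longrightarrow> finite (affine_space R d)"
  by (simp add: affine_space_def finite_PiE)

lemma card_affine_space: "card (affine_space R d) = card (carrier R) ^ d"
  by (simp add: affine_space_def card_PiE)

text \<open>The first term is what equidistributed dot products would give at every
  \<open>x\<close>; the second bounds the total excess over \<open>E\<close>.\<close>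

lemma sum_collisions_sphere_le:
  assumes fin: "finite (carrier R)" and E: "E \<subseteq> unit_sphere R d" and d: "d > 0"
  defines "q \<equiv> real (card (carrier R))"
  shows "(\<Sum>x\<in>E. real (collisions (dot_prod R d x) E))
    \<le> real (card E) ^ 3 / q + 2 * real (card E) * q ^ (d - 1)"
proof -
  define A where "A = affine_space R d"
  \<comment> \<open>The excess of \<open>v\<close> over the Cauchy--Schwarz minimum.\<close>
  define V where "V v = real (collisions (dot_prod R d v) E) - (real (card E))\<^sup>2 / q" for v
  have EA: "E \<subseteq> A"
    using E unit_sphere_dot_prod(1) by (auto simp: A_def)
  have finA: "finite A"
    unfolding A_def using fin by (rule finite_affine_space)
  have finE: "finite E"
    using EA finA by (rule finite_subset)
  have "card {\<zero>, \<one>} \<le> card (carrier R)"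
    using fin by (intro card_mono) auto
  then have q1: "q > 1"
    by (simp add: q_def)
  have qd: "q ^ d = q * q ^ (d - 1)"
    using d by (cases d) auto
  have V_nonneg: "V v \<ge> 0" if "v \<in> A" for v
  proof -
    have "dot_prod R d v ` E \<subseteq> carrier R"
      using EA that by (auto simp: A_def dot_prod_closed)
    from card_squared_le_collisions[OF finE fin this] show ?thesis
      using q1 by (simp add: V_def q_def field_simps)
  qed
  have "(\<Sum>v\<in>A. real (collisions (dot_prod R d v) E))
      = (\<Sum>p\<in>E \<times> E. real (card {v \<in> A. dot_prod R d v (fst p) = dot_prod R d v (snd p)}))"
    unfolding of_nat_sum[symmetric] by (subst sum_collisions[OF finA finE]) (rule refl)
  \<comment> \<open>proof (rule sum_mono)\<close>
  also have "\<dots> \<le> (\<Sum>p\<in>E \<times> E. q ^ (d - 1) + (if fst p = snd p then q ^ d - q ^ (d - 1) else 0))"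
  proof (rule sum_mono)
    fix p assume p: "p \<in> E \<times> E"
    show "real (card {v \<in> A. dot_prod R d v (fst p) = dot_prod R d v (snd p)})
      \<le> q ^ (d - 1) + (if fst p = snd p then q ^ d - q ^ (d - 1) else 0)"
    proof (cases "fst p = snd p")
      case True
      then show ?thesis
        by (simp add: A_def card_affine_space q_def)
    next
      case False
      then show ?thesis
        using p EA card_hyperplane_le[OF fin, of "fst p" d "snd p"]
        by (force simp: A_def q_def simp flip: of_nat_power)
    qed
  qed
  also have "\<dots> = (real (card E))\<^sup>2 * q ^ (d - 1) + real (card E) * (q ^ d - q ^ (d - 1))"
  proof -
    have "(\<Sum>p\<in>E \<times> E. if fst p = snd p then q ^ d - q ^ (d - 1) else 0)
        = (\<Sum>x\<in>E. \<Sum>y\<in>E. if x = y then q ^ d - q ^ (d - 1) else 0)"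
      by (simp add: sum.cartesian_product case_prod_unfold)
    also have "\<dots> = real (card E) * (q ^ d - q ^ (d - 1))"
      using finE by (simp add: sum.delta)
    finally show ?thesis
      by (simp add: sum.distrib card_cartesian_product power2_eq_square)
  qed
  \<comment> \<open>Subtracting \<open>(card E)^2 / q\<close> for each of the \<open>q ^ d\<close>
    vectors removes exactly the quadratic term, so only the diagonal pairs contribute.\<close>
  finally have sum_V: "(\<Sum>v\<in>A. V v) \<le> real (card E) * q ^ (d - 1) * (q - 1)"
    using q1 by (simp add: V_def sum_subtractf A_def card_affine_space qd algebra_simps
        flip: q_def)
  have fin': "finite ((carrier R - {\<zero>}) \<times> E)"
    using fin finE by simp
  \<comment> \<open>Each \<open>x\<close> is replaced by its \<open>q - 1\<close> nonzero multiples,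
    on which \<open>V\<close> is constant; the multiples are then grouped by the vector
    \<open>v\<close> they produce.\<close>
  have "(q - 1) * (\<Sum>x\<in>E. V x) = (\<Sum>s\<in>carrier R - {\<zero>}. \<Sum>x\<in>E. V x)"
    using fin q1 by (simp add: q_def of_nat_diff)
  also have "\<dots> = (\<Sum>s\<in>carrier R - {\<zero>}. \<Sum>x\<in>E. V (scale_vec R d s x))"
    using EA by (intro sum.cong refl) (auto simp: V_def A_def collisions_scale subset_iff)
  also have "\<dots> = (\<Sum>p\<in>(carrier R - {\<zero>}) \<times> E. V (scale_vec R d (fst p) (snd p)))"
    by (simp add: sum.cartesian_product case_prod_unfold)
  also have "\<dots> = (\<Sum>v\<in>A. \<Sum>p\<in>{p \<in> (carrier R - {\<zero>}) \<times> E. scale_vec R d (fst p) (snd p) = v}.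
      V (scale_vec R d (fst p) (snd p)))"
    using EA by (intro sum.group[symmetric] fin' finA) (auto simp: A_def intro!: scale_vec_closed)
  also have "\<dots> = (\<Sum>v\<in>A.
      real (card {p \<in> (carrier R - {\<zero>}) \<times> E. scale_vec R d (fst p) (snd p) = v}) * V v)"
    by (intro sum.cong refl) simp
  \<comment> \<open>\<open>V_nonneg\<close> is essential here: it allows each multiplicity to be
    raised to 2, also at vectors that are no multiple of a point of \<open>E\<close>.\<close>
  also have "\<dots> \<le> (\<Sum>v\<in>A. 2 * V v)"
    using card_scale_fibre_le_2[OF E] V_nonneg by (intro sum_mono mult_right_mono) auto
  also have "\<dots> \<le> (q - 1) * (2 * real (card E) * q ^ (d - 1))"
    using sum_V unfolding sum_distrib_left[symmetric] by (simp add: algebra_simps)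
  \<comment> \<open>The number \<open>q - 1\<close> of scalars cancels against the factor
    \<open>q - 1\<close> in \<open>sum_V\<close>.\<close>
  finally have "(\<Sum>x\<in>E. V x) \<le> 2 * real (card E) * q ^ (d - 1)"
    using q1 by (simp only: mult_le_cancel_left_pos)
  then show ?thesis
    by (simp add: V_def sum_subtractf power3_eq_cube power2_eq_square)
qed

section \<open>Distances on the sphere in odd characteristic\<close>

lemma two_neq_zero:
  assumes "finite (carrier R)" "odd (card (carrier R))"
  shows "\<one> \<oplus> \<one> \<noteq> \<zero>"
proof
  assume two: "\<one> \<oplus> \<one> = \<zero>"
  obtain k where k: "card (carrier R) = 2 * k + 1"
    using assms(2) by (rule oddE)
  \<comment> \<open>The additive group has order \<open>2 * k + 1\<close>, so that multiple of
    \<open>\<one>\<close> vanishes; if 2 were zero, it would equal \<open>\<one>\<close>.\<close>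
  have "\<zero> = add_pow R (2 * k + 1) \<one>"
    using add.pow_order_eq_1[of \<one>] k by (simp add: order_def)
  also have "\<dots> = add_pow R k (add_pow R (2::nat) \<one>) \<oplus> \<one>"
    by (simp add: add.nat_pow_pow)
  also have "add_pow R (2::nat) \<one> = \<zero>"
    using two by (simp add: numeral_2_eq_2)
  also have "add_pow R k \<zero> \<oplus> \<one> = \<one>"
    by simp
  finally show False
    by simp
qed

lemma ff_dist_sphere:
  assumes "x \<in> unit_sphere R d" "y \<in> unit_sphere R d"
  shows "ff_dist R d x y = (\<one> \<oplus> \<one>) \<ominus> (\<one> \<oplus> \<one>) \<otimes> dot_prod R d x y"
proof -
  note x = unit_sphere_dot_prod[OF assms(1)] and y = unit_sphere_dot_prod[OF assms(2)]
  have carr: "x i \<in> carrier R" "y i \<in> carrier R" if "i \<in> {1..d}" for i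
    using x(1) y(1) that by (auto intro: affine_space_coord)
  have dist: "ff_dist R d x y \<in> carrier R"
    unfolding ff_dist_def using carr by (intro finsum_closed) auto
  note dot = dot_prod_closed[OF x(1) y(1)]
  \<comment> \<open>The cross term stands on the left, so that only sums, and no differences, have
    to be combined under \<open>finsum\<close>.\<close>
  have sq: "(a \<ominus> b) [^] (2::nat) \<oplus> (a \<otimes> b \<oplus> a \<otimes> b) = a \<otimes> a \<oplus> b \<otimes> b"
    if "a \<in> carrier R" "b \<in> carrier R" for a b
  proof -
    have "(a \<ominus> b) [^] (2::nat) = (a \<ominus> b) \<otimes> (a \<ominus> b)"
      using that by (simp add: numeral_2_eq_2)
    also have "\<dots> \<oplus> (a \<otimes> b \<oplus> a \<otimes> b) = a \<otimes> a \<oplus> b \<otimes> b"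
      using that by algebra
    finally show ?thesis .
  qed
  have "ff_dist R d x y \<oplus> (dot_prod R d x y \<oplus> dot_prod R d x y)
      = (\<Oplus>i\<in>{1..d}. (x i \<ominus> y i) [^] (2::nat) \<oplus> (x i \<otimes> y i \<oplus> x i \<otimes> y i))"
    unfolding ff_dist_def dot_prod_def using carr
    by (simp add: finsum_addf)
  also have "\<dots> = (\<Oplus>i\<in>{1..d}. x i \<otimes> x i \<oplus> y i \<otimes> y i)"
    using carr sq by (intro finsum_cong') auto
  also have "\<dots> = dot_prod R d x x \<oplus> dot_prod R d y y"
    unfolding dot_prod_def using carr by (intro finsum_addf) auto
  finally have eq: "ff_dist R d x y \<oplus> (dot_prod R d x y \<oplus> dot_prod R d x y) = \<one> \<oplus> \<one>"
    using x(2) y(2) by simp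
  have diff: "ff_dist R d x y = (ff_dist R d x y \<oplus> (dot_prod R d x y \<oplus> dot_prod R d x y))
      \<ominus> (\<one> \<oplus> \<one>) \<otimes> dot_prod R d x y"
    using dist dot by algebra
  show ?thesis
    using diff unfolding eq .
qed

text \<open>By \<open>ff_dist_sphere\<close> the distances are the image of the dot products under
  \<open>t \<mapsto> 2 - 2 t\<close>, which is injective because 2 is nonzero.\<close>

lemma card_distance_set_sphere:
  assumes "finite (carrier R)" "odd (card (carrier R))" "E \<subseteq> unit_sphere R d"
  shows "card (distance_set R d E) = card ((\<lambda>(x, y). dot_prod R d x y) ` (E \<times> E))"
proof -
  define h where "h t = (\<one> \<oplus> \<one>) \<ominus> (\<one> \<oplus> \<one>) \<otimes> t" for t
  have inj: "inj_on h (carrier R)"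
  proof (rule inj_onI)
    fix s t assume st: "s \<in> carrier R" "t \<in> carrier R" "h s = h t"
    have "(\<one> \<oplus> \<one>) \<otimes> s = (\<one> \<oplus> \<one>) \<ominus> h s" "(\<one> \<oplus> \<one>) \<otimes> t = (\<one> \<oplus> \<one>) \<ominus> h t"
      unfolding h_def using st(1,2) by algebra+
    then show "s = t"
      using st two_neq_zero[OF assms(1,2)] m_lcancel[of "\<one> \<oplus> \<one>" s t] by simp
  qed
  have "distance_set R d E = (\<lambda>(x, y). ff_dist R d x y) ` (E \<times> E)"
    by (auto simp: distance_set_def)
  also have "\<dots> = (\<lambda>(x, y). h (dot_prod R d x y)) ` (E \<times> E)"
    using assms(3) by (intro image_cong) (auto simp: h_def ff_dist_sphere subset_iff)
  also have "\<dots> = h ` (\<lambda>(x, y). dot_prod R d x y) ` (E \<times> E)"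
    by (simp add: image_image case_prod_unfold)
  finally have "distance_set R d E = h ` (\<lambda>(x, y). dot_prod R d x y) ` (E \<times> E)" .
  moreover have "(\<lambda>(x, y). dot_prod R d x y) ` (E \<times> E) \<subseteq> carrier R"
    using assms(3) unit_sphere_dot_prod(1) by (auto intro!: dot_prod_closed)
  ultimately show ?thesis
    using inj by (simp add: card_image inj_on_subset)
qed

text \<open>The size condition says \<open>q ^ d \<le> (card E)^2\<close>, which makes the error
  term of \<open>sum_collisions_sphere_le\<close> at most twice its main term. This gives the
  constant 3 = 1 + 2.\<close>

lemma card_distance_set_ge:
  assumes fin: "finite (carrier R)" and odd: "odd (card (carrier R))"
    and E: "E \<subseteq> unit_sphere R d" and d: "d > 0"
    and large: "real (card E) \<ge> real (card (carrier R)) powr (real d / 2)"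
  shows "real (card (carrier R)) \<le> 3 * real (card (distance_set R d E))"
proof -
  define q e where "q = real (card (carrier R))" and "e = real (card E)"
  define P where "P = (\<lambda>(x, y). dot_prod R d x y) ` (E \<times> E)"
  have "q > 0"
    using fin by (auto simp: q_def card_gt_0_iff)
  then have e: "e \<ge> q powr (real d / 2)" "e > 0"
    using large less_le_trans[of 0 "q powr (real d / 2)" e] by (auto simp: q_def e_def)
  have "q ^ d = q powr (real d / 2 + real d / 2)"
    using \<open>q > 0\<close> by (simp add: powr_realpow)
  also have "\<dots> = (q powr (real d / 2))\<^sup>2"
    by (simp only: powr_add power2_eq_square)
  also have "\<dots> \<le> e\<^sup>2"
    using e by (intro power_mono) auto
  finally have "q * q ^ (d - 1) \<le> e\<^sup>2"
    using d by (cases d) auto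
  then have "q ^ (d - 1) \<le> e\<^sup>2 / q"
    using \<open>q > 0\<close> by (simp add: field_simps)
  then have "2 * e * q ^ (d - 1) \<le> 2 * e * (e\<^sup>2 / q)"
    using e by (intro mult_left_mono) auto
  also have "\<dots> = 2 * e ^ 3 / q"
    by (simp add: power3_eq_cube power2_eq_square)
  finally have main: "(\<Sum>x\<in>E. real (collisions (dot_prod R d x) E)) \<le> 3 * e ^ 3 / q"
    using sum_collisions_sphere_le[OF fin E d] by (simp add: q_def e_def)
  \<comment> \<open>An infinite set has \<open>card\<close> 0, so a positive \<open>e\<close> forces
    finiteness.\<close>
  have finE: "finite E"
    using e(2) card_ge_0_finite by (simp add: e_def)
  then have finP: "finite P"
    by (simp add: P_def)
  have "e ^ 3 = (\<Sum>x\<in>E. e\<^sup>2)"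
    by (simp add: e_def power3_eq_cube power2_eq_square)
  \<comment> \<open>For each \<open>x\<close> in \<open>E\<close> all dot products with
    \<open>E\<close> lie in \<open>P\<close>, so \<open>P\<close> can take the place of the field in
    Cauchy--Schwarz.\<close>
  also have "\<dots> \<le> (\<Sum>x\<in>E. real (card P) * real (collisions (dot_prod R d x) E))"
    unfolding e_def using finE finP
    by (intro sum_mono card_squared_le_collisions) (auto simp: P_def)
  also have "\<dots> \<le> real (card P) * (3 * e ^ 3 / q)"
    unfolding sum_distrib_left[symmetric] using main by (intro mult_left_mono) auto
  finally have "e ^ 3 * q \<le> e ^ 3 * (3 * real (card P))"
    using \<open>q > 0\<close> by (simp add: field_simps)
  then have "q \<le> 3 * real (card P)"
    using e(2) by (simp only: mult_le_cancel_left_pos zero_less_power)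
  then show ?thesis
    using card_distance_set_sphere[OF fin odd E] by (simp add: q_def P_def)
qed

end

theorem theorem4:
  fixes d :: nat
  assumes "d \<ge> 3"
  shows "\<exists>C c :: real. C > 0 \<and> c > 0 \<and>
    (\<forall>(q::nat) (F :: 'a ring) E.
       primepow q \<and> odd q \<and> field F \<and> finite (carrier F) \<and> card (carrier F) = q \<and>
       E \<subseteq> unit_sphere F d \<and> real (card E) \<ge> C * real q powr (real d / 2) \<longrightarrow>
       real (card (distance_set F d E)) > c * real q)"
\<comment> \<open>\<open>C = 1\<close> suffices for the non-strict bound with factor 1/3; the
  smaller \<open>c = 1/4\<close> makes it strict, since \<open>q\<close> is positive.\<close>
proof (rule exI[of _ 1], rule exI[of _ "1/4"], intro conjI allI impI)
  fix q :: nat and F :: "'a ring" and E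
  assume *: "primepow q \<and> odd q \<and> field F \<and> finite (carrier F) \<and> card (carrier F) = q \<and>
    E \<subseteq> unit_sphere F d \<and> real (card E) \<ge> 1 * real q powr (real d / 2)"
  then have "real q \<le> 3 * real (card (distance_set F d E))"
    using field.card_distance_set_ge[of F E d] assms by auto
  moreover have "real q > 0"
    using * by (auto intro: Nat.gr0I)
  ultimately show "real (card (distance_set F d E)) > 1 / 4 * real q"
    by linarith
qed auto

end
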